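(* Let $(m,w,f)$ be a triple of vectors of respectively $|\mathcal P|$, $|\mathcal P|$ and $|\mathcal Q|$ functions from $\mathbb R_{\ge0}$ to $\mathbb R_{\ge0}$, with all the $m_p$ constant and all the $w_p$ affine. Then $(m,w,f)$ is a stationary solution of the continuous dynamics of the Petri net with free choice and priority routing if and only if the following conditions hold (at all times): $$\frac{m}{\tau}=C^+f,\qquad \dot w=\frac m\tau-C^-f,\qquad Cf\ge0,$$ and there exists a policy $\pi^*$ such that $$\forall t,\ S_{\pi^*}w(t)=0,\qquad (S_{\pi^*}C^+-C^-_{\pi^*})f=0 .$$
   Context: Net. A Petri net consists of a finite set $\mathcal P$ of places, a finite set $\mathcal Q$ of transitions, and valuations $a^+_{qp}\in\mathbb N$ of the arc from transition $q$ to place $p$ and $a^-_{qp}\in\mathbb N$ of the arc from place $p$ to transition $q$ (value $0$ meaning no arc). The net is pure: for each $(q,p)$ at least one of $a^+_{qp},a^-_{qp}$ is $0$. $C^+,C^-$ are the $\mathcal P\times\mathcal Q$ matrices with $(p,q)$ entries $a^+_{qp}$, $a^-_{qp}$, and $C=C^+-C^-$. Write $q^{\mathrm{in}}=\{p: a^-_{qp}>0\}$ and $p^{\mathrm{out}}=\{q:a^-_{qp}>0\}$. The net is strongly connected and autonomous; in particular each transition has at least one upstream place. Every place is either free choice (either $q^{\mathrm{in}}=\{p\}$ for all $q\in p^{\mathrm{out}}$, or $|p^{\mathrm{out}}|=1$) or subject to priority. $\mathcal P_{\mathsf{conflict}}$ is the set of free choice places with at least two output transitions; $\mathcal P_{\mathsf{priority}}$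 is the set of places subject to priority; $\mathcal Q_{\mathsf{sync}}$ is the set of transitions all of whose upstream places $p$ are free choice with $|p^{\mathrm{out}}|=1$. Each $p\in\mathcal P_{\mathsf{priority}}$ has exactly two output transitions, $q_+=q_+(p)$ (with priority) and $q_-=q_-(p)$; each transition has at most one upstream place in $\mathcal P_{\mathsf{priority}}$. Each place has a time constant $\tau_p>0$, and for $p\in\mathcal P_{\mathsf{conflict}}$, $q\in p^{\mathrm{out}}$ there are weights $\mu_{qp}>0$ with $\sum_{q\in p^{\mathrm{out}}}\mu_{qp}=1$. Denote by $m/\tau$ the vector $(m_p/\tau_p)_{p\in\mathcal P}$. Dynamics. The continuous dynamics of $(m,w,f)$ (nonnegative functions of $t\ge0$) consists of the equations $\dot m(t)=C^+f(t)-m(t)/\tau$, $\dot w(t)=m(t)/\tau-C^-f(t)$, together with the requirements that at every $t$ each transition $q$ has an upstream place $p$ with $w_p(t)=0$, and (a minimum over the empty set being $+\infty$) - for $q\in\mathcal Q_{\mathsf{sync}}$: $f_q(t)=\min_{p\in q^{\mathrm{in}},w_p(t)=0}\frac{m_p(t)}{a^-_{qp}\tau_p}$; - for $p\in\mathcal P_{\mathsf{conflict}}$, $q\in p^{\mathrm{out}}$: $a^-_{qp}f_q(t)=\mu_{qp}\frac{m_p(t)}{\tau_p}$; - for $p\in\mathcal P_{\mathsf{priority}}$: $f_{q_+}(t)=\min_{r\in q_+^{\mathrm{in}},w_r(t)=0}\frac{m_r(t)}{a^-_{q_+r}\tau_r}$, and $f_{q_-}(t)=\min_{r\in q_-^{\mathrm{in}}\setminus\{p\},w_r(t)=0}\frac{m_r(t)}{a^-_{q_-r}\tau_r}$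 if $w_p(t)\ne0$, while if $w_p(t)=0$, $f_{q_-}(t)=\min\Big(\frac{m_p(t)}{a^-_{q_-p}\tau_p}-\frac{a^-_{q_+p}}{a^-_{q_-p}}f_{q_+}(t),\ \min_{r\in q_-^{\mathrm{in}}\setminus\{p\},w_r(t)=0}\frac{m_r(t)}{a^-_{q_-r}\tau_r}\Big)$. A stationary solution is a solution $(m,w,f)$ of the continuous dynamics on $[0,\infty)$ such that for every place $p$, $m_p$ is constant and $w_p$ is affine. Policies. A policy $\pi$ maps each transition $q$ to one of its upstream places $p_\pi(q)\in q^{\mathrm{in}}$. $S_\pi$ is the $\mathcal Q\times\mathcal P$ matrix with $(S_\pi)_{qp}=1$ if $p=p_\pi(q)$ and $0$ otherwise. $C^-_\pi$ is the $\mathcal Q\times\mathcal Q$ matrix such that, with $p=p_\pi(q)$: $(C^-_\pi f)_q=a^-_{qp}f_q$ if $p\notin\mathcal P_{\mathsf{conflict}}\cup\mathcal P_{\mathsf{priority}}$; $(C^-_\pi f)_q=\frac{a^-_{qp}}{\mu_{qp}}f_q$ if $p\in\mathcal P_{\mathsf{conflict}}$; $(C^-_\pi f)_q=a^-_{qp}f_q$ if $p\in\mathcal P_{\mathsf{priority}}$ and $q=q_+(p)$; $(C^-_\pi f)_q=a^-_{qp}f_q+a^-_{q_+p}f_{q_+}$ if $p\in\mathcal P_{\mathsf{priority}}$, $q=q_-(p)$ and $q_+=q_+(p)$. *)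

theory Defs
  imports "HOL-Analysis.Analysis" "HOL-Library.Extended_Real" "Graph_Theory.Digraph_Component"
begin

text \<open>
  Places and transitions are the elements of two finite types. \<open>a_plus N q p\<close> is the valuation of
  the arc from \<open>q\<close> to \<open>p\<close>, \<open>a_minus N q p\<close> the one of the arc from \<open>p\<close> to \<open>q\<close>. Being subject to
  priority is a piece of data (the routing rule attached to the place), hence the field
  \<open>P_priority\<close>; \<open>mu N q p\<close> is only meaningful for conflict places \<open>p\<close>, \<open>q_plus\<close> and \<open>q_minus\<close> only
  for priority places.
\<close>

record ('p, 'q) petri_net =
  a_plus :: "'q \<Rightarrow> 'p \<Rightarrow> nat"
  a_minus :: "'q \<Rightarrow> 'p \<Rightarrow> nat"
  tau :: "'p \<Rightarrow> real"
  mu :: "'q \<Rightarrow> 'p \<Rightarrow> real"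
  P_priority :: "'p set"
  q_plus :: "'p \<Rightarrow> 'q"
  q_minus :: "'p \<Rightarrow> 'q"

definition q_in :: "('p, 'q) petri_net \<Rightarrow> 'q \<Rightarrow> 'p set" where
  "q_in N q = {p. a_minus N q p > 0}"

definition p_out :: "('p, 'q) petri_net \<Rightarrow> 'p \<Rightarrow> 'q set" where
  "p_out N p = {q. a_minus N q p > 0}"

definition net_digraph :: "('p, 'q) petri_net \<Rightarrow> ('p + 'q) pair_pre_digraph" where
  "net_digraph N = \<lparr> pverts = UNIV,
     parcs = {(Inl p, Inr q) | p q. a_minus N q p > 0} \<union> {(Inr q, Inl p) | q p. a_plus N q p > 0} \<rparr>"

text \<open>A place subject to priority is not counted as a free choice place, even when its output
  transitions happen to have no other upstream place.\<close>

definition P_free_choice :: "('p, 'q) petri_net \<Rightarrow> 'p set" where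
  "P_free_choice N = {p. p \<notin> P_priority N \<and>
     ((\<forall>q\<in>p_out N p. q_in N q = {p}) \<or> card (p_out N p) = 1)}"

definition P_conflict :: "('p, 'q) petri_net \<Rightarrow> 'p set" where
  "P_conflict N = {p \<in> P_free_choice N. card (p_out N p) \<ge> 2}"

definition Q_sync :: "('p, 'q) petri_net \<Rightarrow> 'q set" where
  "Q_sync N = {q. \<forall>p\<in>q_in N q. p \<in> P_free_choice N \<and> card (p_out N p) = 1}"

locale fc_priority_net =
  fixes N :: "('p::finite, 'q::finite) petri_net"
  assumes pure: "a_plus N q p = 0 \<or> a_minus N q p = 0"
    and strongly_conn: "strongly_connected (with_proj (net_digraph N))"
    and autonomous: "q_in N q \<noteq> {}"
    and routing: "p \<in> P_free_choice N \<or> p \<in> P_priority N"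
    and priority_out: "p \<in> P_priority N \<Longrightarrow>
          q_plus N p \<noteq> q_minus N p \<and> p_out N p = {q_plus N p, q_minus N p}"
    and priority_in: "card (q_in N q \<inter> P_priority N) \<le> 1"
    and tau_pos: "tau N p > 0"
    and mu_pos: "p \<in> P_conflict N \<Longrightarrow> q \<in> p_out N p \<Longrightarrow> mu N q p > 0"
    and mu_sum: "p \<in> P_conflict N \<Longrightarrow> (\<Sum>q\<in>p_out N p. mu N q p) = 1"

definition C_plus :: "('p::finite, 'q::finite) petri_net \<Rightarrow> real^'q^'p" where
  "C_plus N = (\<chi> p q. real (a_plus N q p))"

definition C_minus :: "('p::finite, 'q::finite) petri_net \<Rightarrow> real^'q^'p" where
  "C_minus N = (\<chi> p q. real (a_minus N q p))"

definition C_mat :: "('p::finite, 'q::finite) petri_net \<Rightarrow> real^'q^'p" where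
  "C_mat N = C_plus N - C_minus N"

definition over_tau :: "('p::finite, 'q) petri_net \<Rightarrow> real^'p \<Rightarrow> real^'p" where
  "over_tau N m = (\<chi> p. m $ p / tau N p)"


text \<open>Adding \<open>\<infinity>\<close> to the set realises the convention that a minimum over the empty set is \<open>\<infinity>\<close>.\<close>

definition min_rate :: "('p::finite, 'q) petri_net \<Rightarrow> real^'p \<Rightarrow> real^'p \<Rightarrow> 'q \<Rightarrow> 'p set \<Rightarrow> ereal" where
  "min_rate N m w q A =
     Min (insert \<infinity> ((\<lambda>r. ereal (m $ r / (real (a_minus N q r) * tau N r))) ` {r \<in> A. w $ r = 0}))"

text \<open>The conditions at a fixed time that do not involve derivatives.\<close>

definition flow_rules ::
  "('p::finite, 'q::finite) petri_net \<Rightarrow> real^'p \<Rightarrow> real^'p \<Rightarrow> real^'q \<Rightarrow> bool" where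
  "flow_rules N m w f \<longleftrightarrow>
     (\<forall>q. \<exists>p\<in>q_in N q. w $ p = 0) \<and>
     (\<forall>q\<in>Q_sync N. ereal (f $ q) = min_rate N m w q (q_in N q)) \<and>
     (\<forall>p\<in>P_conflict N. \<forall>q\<in>p_out N p.
        real (a_minus N q p) * f $ q = mu N q p * (m $ p / tau N p)) \<and>
     (\<forall>p\<in>P_priority N. let qp = q_plus N p; qm = q_minus N p in
        ereal (f $ qp) = min_rate N m w qp (q_in N qp) \<and>
        (w $ p \<noteq> 0 \<longrightarrow> ereal (f $ qm) = min_rate N m w qm (q_in N qm - {p})) \<and>
        (w $ p = 0 \<longrightarrow> ereal (f $ qm) =
           min (ereal (m $ p / (real (a_minus N qm p) * tau N p)
                       - real (a_minus N qp p) / real (a_minus N qm p) * f $ qp))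
               (min_rate N m w qm (q_in N qm - {p}))))"

text \<open>Functions on \<open>[0, \<infinity>)\<close> are represented by functions on \<open>real\<close> whose values at negative times
  are irrelevant; derivatives are taken within \<open>[0, \<infinity>)\<close>, hence one-sided at \<open>0\<close>.\<close>

definition continuous_dynamics ::
  "('p::finite, 'q::finite) petri_net \<Rightarrow>
   (real \<Rightarrow> real^'p) \<Rightarrow> (real \<Rightarrow> real^'p) \<Rightarrow> (real \<Rightarrow> real^'q) \<Rightarrow> bool" where
  "continuous_dynamics N m w f \<longleftrightarrow>
     (\<forall>t\<ge>0. 0 \<le> m t \<and> 0 \<le> w t \<and> 0 \<le> f t) \<and>
     (\<forall>t\<ge>0. (m has_vector_derivative (C_plus N *v f t - over_tau N (m t))) (at t within {0..})) \<and>
     (\<forall>t\<ge>0. (w has_vector_derivative (over_tau N (m t) - C_minus N *v f t)) (at t within {0..})) \<and>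
     (\<forall>t\<ge>0. flow_rules N (m t) (w t) (f t))"

definition affine_on_nonneg :: "(real \<Rightarrow> real) \<Rightarrow> bool" where
  "affine_on_nonneg g \<longleftrightarrow> (\<exists>a b. \<forall>t\<ge>0. g t = a + b * t)"

definition stationary_solution ::
  "('p::finite, 'q::finite) petri_net \<Rightarrow>
   (real \<Rightarrow> real^'p) \<Rightarrow> (real \<Rightarrow> real^'p) \<Rightarrow> (real \<Rightarrow> real^'q) \<Rightarrow> bool" where
  "stationary_solution N m w f \<longleftrightarrow> continuous_dynamics N m w f \<and>
     (\<forall>p. (\<lambda>t. m t $ p) constant_on {0..} \<and> affine_on_nonneg (\<lambda>t. w t $ p))"


definition policy :: "('p, 'q) petri_net \<Rightarrow> ('q \<Rightarrow> 'p) \<Rightarrow> bool" where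
  "policy N \<pi> \<longleftrightarrow> (\<forall>q. \<pi> q \<in> q_in N q)"

definition S_pol :: "('q::finite \<Rightarrow> 'p::finite) \<Rightarrow> real^'p^'q" where
  "S_pol \<pi> = (\<chi> q p. if p = \<pi> q then 1 else 0)"

definition C_minus_pol_map ::
  "('p::finite, 'q::finite) petri_net \<Rightarrow> ('q \<Rightarrow> 'p) \<Rightarrow> real^'q \<Rightarrow> real^'q" where
  "C_minus_pol_map N \<pi> f = (\<chi> q. let p = \<pi> q in
     if p \<in> P_conflict N then real (a_minus N q p) / mu N q p * f $ q
     else if p \<in> P_priority N \<and> q = q_minus N p then
       real (a_minus N q p) * f $ q + real (a_minus N (q_plus N p) p) * f $ q_plus N p
     else real (a_minus N q p) * f $ q)"

definition C_minus_pol ::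
  "('p::finite, 'q::finite) petri_net \<Rightarrow> ('q \<Rightarrow> 'p) \<Rightarrow> real^'q^'q" where
  "C_minus_pol N \<pi> = matrix (C_minus_pol_map N \<pi>)"

lemma C_minus_pol_mult: "C_minus_pol N \<pi> *v f = C_minus_pol_map N \<pi> f"
proof -
  have "linear (C_minus_pol_map N \<pi>)"
    by (rule linearI) (simp_all add: C_minus_pol_map_def vec_eq_iff Let_def algebra_simps add_divide_distrib)
  then show ?thesis
    by (simp add: C_minus_pol_def matrix_vector_mul(2))
qed

end

theory Submission
  imports Defs
begin

text \<open>
  The statement is mostly about a single instant. At such an instant, choose for every transition
  \<open>q\<close> an upstream place that realises the minimum defining \<open>f\<^sub>q\<close>. Clearing denominators, the rule
  for \<open>q\<close> says that the chosen place \<open>r\<close> has \<open>w\<^sub>r = 0\<close> and that it passes on its whole processed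
  flow \<open>m\<^sub>r / \<tau>\<^sub>r\<close> in the way recorded by row \<open>q\<close> of \<open>C\<^sup>-\<^sub>\<pi>\<close> (\<open>flow_rules_imp_policy\<close>).
  Conversely, \<open>m/\<tau> = C\<^sup>+ f\<close> and \<open>C f \<ge> 0\<close> give \<open>C\<^sup>- f \<le> m/\<tau>\<close>, which bounds \<open>f\<^sub>q\<close>
  from above by every term of the minimum, so that it only remains to know that one of the terms is attained, which the policy
  provides (\<open>policy_imp_flow_rules\<close>). Both directions rest on the classification of the upstream
  places of a transition: apart from a conflict place (then the only upstream place) and a priority
  place (at most one), each of them feeds this transition alone, so that the
  component of \<open>C\<^sup>- f\<close> at such a place is a multiple of \<open>f\<^sub>q\<close>.

  The passage from one instant to all of \<open>[0, \<infinity>)\<close> needs a policy that is independent of time. A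
  nonnegative affine function that vanishes at time \<open>1\<close> vanishes on \<open>[0, \<infinity>)\<close>, so the places
  selected at time \<open>1\<close> keep \<open>w = 0\<close>. The flow \<open>f\<close> is not assumed constant, and time \<open>0\<close> is special
  because more places may have \<open>w\<^sub>p(0) = 0\<close> than \<open>w\<^sub>p(t) = 0\<close> for \<open>t > 0\<close>. However \<open>w\<close> being
  affine makes \<open>C\<^sup>- f\<close> constant, and the routing rules determine \<open>f\<close> from \<open>m\<close> and \<open>C\<^sup>- f\<close>
  whatever \<open>w\<close> is (\<open>flow_rules_unique\<close>), so \<open>f\<close> is constant after all.
\<close>

section \<open>Affine functions on the half-line\<close>

lemma nonneg_affine_slope_nonneg:
  fixes a b :: real
  assumes "\<And>t. t \<ge> 0 \<Longrightarrow> 0 \<le> a + b * t"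
  shows "0 \<le> b"
proof (rule ccontr)
  assume "\<not> 0 \<le> b"
  moreover have "0 \<le> a" using assms[of 0] by simp
  \<comment> \<open>the time at which the function takes the value \<open>-1\<close>\<close>
  ultimately have "0 \<le> a + b * ((a + 1) / - b)" by (intro assms) (auto intro: divide_nonneg_neg)
  with \<open>\<not> 0 \<le> b\<close> show False by (simp add: field_simps)
qed

lemma nonneg_affine_zero:
  assumes "affine_on_nonneg g" "\<And>t. t \<ge> 0 \<Longrightarrow> 0 \<le> g t" "g s = 0" "s > 0" "t \<ge> 0"
  shows "g t = 0"
proof -
  obtain a b where ab: "\<And>t. t \<ge> 0 \<Longrightarrow> g t = a + b * t"
    using assms(1) unfolding affine_on_nonneg_def by blast
  have "0 \<le> b"
    by (rule nonneg_affine_slope_nonneg[of a]) (use assms(2) ab in \<open>metis\<close>)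
  moreover have "0 \<le> a" using assms(2)[of 0] ab[of 0] by simp
  moreover have "a + b * s = 0" using ab[of s] assms(3,4) by simp
  ultimately have "a = 0 \<and> b * s = 0" using assms(4) by (simp add: add_nonneg_eq_0_iff)
  then show ?thesis using ab[OF assms(5)] assms(4) by simp
qed

lemma half_line_derivative_unique:
  fixes g h :: "real \<Rightarrow> 'a::real_normed_vector"
  assumes "(g has_vector_derivative x) (at t within {0..})"
    and "(h has_vector_derivative y) (at t within {0..})"
    and "\<And>s. s \<ge> 0 \<Longrightarrow> g s = h s" "t \<ge> 0"
  shows "x = y"
proof (rule vector_derivative_unique_within)
  have "at_right t \<le> at t within {0..}" using \<open>t \<ge> 0\<close> by (intro at_le) auto
  then show "at t within {0..} \<noteq> bot" using trivial_limit_at_right_real[of t] by (metis bot.extremum_uniqueI)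
  show "(g has_vector_derivative x) (at t within {0..})" by fact
  show "(g has_vector_derivative y) (at t within {0..})"
    by (rule has_vector_derivative_transform[OF _ _ assms(2)]) (use assms(3,4) in auto)
qed

text \<open>The second conclusion includes time \<open>0\<close>, where the derivative is one-sided; it is what prevents
  the flow from jumping there.\<close>

lemma affine_derivative_nonneg_const:
  fixes w :: "real \<Rightarrow> real^'p"
  assumes aff: "\<forall>p. affine_on_nonneg (\<lambda>t. w t $ p)"
    and nn: "\<forall>t\<ge>0. 0 \<le> w t"
    and der: "\<forall>t\<ge>0. (w has_vector_derivative d t) (at t within {0..})"
  shows "t \<ge> 0 \<Longrightarrow> 0 \<le> d t" and "s \<ge> 0 \<Longrightarrow> t \<ge> 0 \<Longrightarrow> d s = d t"
proof -
  have "\<exists>b\<ge>0. \<forall>t\<ge>0. d t $ p = b" for p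
  proof -
    obtain a b where ab: "\<And>t. t \<ge> 0 \<Longrightarrow> w t $ p = a + b * t"
      using aff unfolding affine_on_nonneg_def by blast
    have "0 \<le> b"
    proof (rule nonneg_affine_slope_nonneg)
      show "0 \<le> a + b * t" if "t \<ge> 0" for t
        using nn[rule_format, OF that] unfolding ab[OF that, symmetric] by (simp add: less_eq_vec_def)
    qed
    moreover have "d t $ p = b" if t: "t \<ge> 0" for t
    proof -
      show ?thesis
      proof (rule half_line_derivative_unique[OF _ _ ab t])
        show "((\<lambda>t. w t $ p) has_vector_derivative d t $ p) (at t within {0..})"
          using der t by (intro bounded_linear.has_vector_derivative[OF bounded_linear_vec_nth]) auto
        have "((\<lambda>t. a + b * t) has_real_derivative b) (at t within {0..})"
          by (auto intro!: derivative_eq_intros)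
        then show "((\<lambda>t. a + b * t) has_vector_derivative b) (at t within {0..})"
          by (simp add: has_real_derivative_iff_has_vector_derivative)
      qed
    qed
    ultimately show ?thesis by blast
  qed
  then obtain b where "\<And>p. b p \<ge> 0" "\<And>p t. t \<ge> 0 \<Longrightarrow> d t $ p = b p" by metis
  then show "t \<ge> 0 \<Longrightarrow> 0 \<le> d t" and "s \<ge> 0 \<Longrightarrow> t \<ge> 0 \<Longrightarrow> d s = d t"
    by (simp_all add: less_eq_vec_def vec_eq_iff)
qed

section \<open>Classification of upstream places\<close>

text \<open>Neither weights nor priorities affect what such a place sends to \<open>q\<close>: with a single output
  transition, it is not a conflict place either.\<close>

definition dedicated :: "('p, 'q) petri_net \<Rightarrow> 'q \<Rightarrow> 'p \<Rightarrow> bool" where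
  "dedicated N q r \<longleftrightarrow> r \<notin> P_priority N \<and> p_out N r = {q}"

lemma q_in_iff_p_out: "r \<in> q_in N q \<longleftrightarrow> q \<in> p_out N r"
  by (simp add: q_in_def p_out_def)

lemma C_minus_nth:
  "(C_minus N *v f) $ p = (\<Sum>q\<in>p_out N p. real (a_minus N q p) * f $ q)"
  unfolding C_minus_def matrix_vector_mult_def
  by (auto simp: p_out_def intro!: sum.mono_neutral_right)

lemma C_minus_dedicated:
  "dedicated N q r \<Longrightarrow> (C_minus N *v f) $ r = real (a_minus N q r) * f $ q"
  by (simp add: C_minus_nth dedicated_def)

lemma C_minus_pol_dedicated:
  assumes "dedicated N q (\<pi> q)"
  shows "C_minus_pol_map N \<pi> f $ q = real (a_minus N q (\<pi> q)) * f $ q"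
  using assms by (simp add: C_minus_pol_map_def dedicated_def P_conflict_def)

lemma conflict_not_priority: "p \<in> P_conflict N \<Longrightarrow> p \<notin> P_priority N"
  by (simp add: P_conflict_def P_free_choice_def)

lemma C_minus_pol_conflict:
  assumes "\<pi> q \<in> P_conflict N"
  shows "C_minus_pol_map N \<pi> f $ q = real (a_minus N q (\<pi> q)) / mu N q (\<pi> q) * f $ q"
  using assms by (simp add: C_minus_pol_map_def Let_def)

lemma conflict_q_in: "p \<in> P_conflict N \<Longrightarrow> q \<in> p_out N p \<Longrightarrow> q_in N q = {p}"
  by (auto simp: P_conflict_def P_free_choice_def)

lemma sync_dedicated:
  assumes "q \<in> Q_sync N" "r \<in> q_in N q"
  shows "dedicated N q r"
proof -
  have "r \<notin> P_priority N" "card (p_out N r) = 1" "q \<in> p_out N r"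
    using assms by (auto simp: Q_sync_def P_free_choice_def simp flip: q_in_iff_p_out)
  then show ?thesis by (metis card_1_singletonE dedicated_def singletonD)
qed

context fc_priority_net
begin

text \<open>Every transition is governed by one of the routing rules: an upstream place that prevents it
  from being in \<open>Q_sync\<close> is a conflict place or a priority place.\<close>

lemma transition_cases [case_names sync conflict priority_plus priority_minus]:
  obtains "q \<in> Q_sync N"
  | p where "p \<in> P_conflict N" "q \<in> p_out N p"
  | p where "p \<in> P_priority N" "q = q_plus N p"
  | p where "p \<in> P_priority N" "q = q_minus N p"
proof (cases "q \<in> Q_sync N")
  case False
  then obtain p where p: "p \<in> q_in N q" "\<not> (p \<in> P_free_choice N \<and> card (p_out N p) = 1)"
    by (auto simp: Q_sync_def)
  then have q: "q \<in> p_out N p" by (simp add: q_in_iff_p_out)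
  show thesis
  proof (cases "p \<in> P_priority N")
    case True
    then show thesis using priority_out[of p] q that by auto
  next
    case False
    moreover have "card (p_out N p) \<noteq> 0" using q by auto
    ultimately have "p \<in> P_conflict N" using p(2) routing[of p] unfolding P_conflict_def by force
    then show thesis using q that by blast
  qed
qed (use that in blast)

lemma priority_dedicated:
  assumes "p \<in> P_priority N" "q \<in> p_out N p" "r \<in> q_in N q - {p}"
  shows "dedicated N q r"
proof -
  have p: "p \<in> q_in N q" using assms(2) by (simp add: q_in_iff_p_out)
  have "r \<notin> P_priority N"
    using priority_in[of q] p assms by (auto simp: card_le_Suc0_iff_eq)
  moreover from this have "card (p_out N r) = 1"
    using routing[of r] p assms(3) by (auto simp: P_free_choice_def simp flip: q_in_iff_p_out)
  moreover have "q \<in> p_out N r" using assms(3) by (simp flip: q_in_iff_p_out)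
  ultimately show ?thesis by (metis card_1_singletonE dedicated_def singletonD)
qed

lemma C_minus_priority:
  assumes "p \<in> P_priority N"
  shows "(C_minus N *v f) $ p = real (a_minus N (q_plus N p) p) * f $ q_plus N p
                                + real (a_minus N (q_minus N p) p) * f $ q_minus N p"
  using priority_out[OF assms] by (simp add: C_minus_nth)

lemma C_minus_pol_priority:
  assumes "\<pi> q \<in> P_priority N"
  shows "q = q_plus N (\<pi> q) \<Longrightarrow>
           C_minus_pol_map N \<pi> f $ q = real (a_minus N q (\<pi> q)) * f $ q"
    and "q = q_minus N (\<pi> q) \<Longrightarrow>
           C_minus_pol_map N \<pi> f $ q = real (a_minus N q (\<pi> q)) * f $ q
             + real (a_minus N (q_plus N (\<pi> q)) (\<pi> q)) * f $ q_plus N (\<pi> q)"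
  using assms priority_out[OF assms] conflict_not_priority[of "\<pi> q" N]
  by (auto simp: C_minus_pol_map_def Let_def)

section \<open>The routing rules at a fixed time\<close>

lemma rate_iff:
  assumes "r \<in> q_in N q"
  shows "x \<le> m $ r / (real (a_minus N q r) * tau N r)
           \<longleftrightarrow> real (a_minus N q r) * x \<le> over_tau N m $ r"
    and "x = m $ r / (real (a_minus N q r) * tau N r)
           \<longleftrightarrow> real (a_minus N q r) * x = over_tau N m $ r"
  using assms tau_pos[of r] by (auto simp: q_in_def over_tau_def field_simps)

lemma le_min_rate_iff:
  assumes "A \<subseteq> q_in N q"
  shows "ereal x \<le> min_rate N m w q A \<longleftrightarrow>
    (\<forall>r\<in>A. w $ r = 0 \<longrightarrow> real (a_minus N q r) * x \<le> over_tau N m $ r)"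
  using assms by (auto simp: min_rate_def rate_iff(1) subset_iff)

text \<open>A minimum is a lower bound that is attained. The element \<open>\<infinity>\<close> added for the empty set is never
  equal to the real number \<open>x\<close>, which is why the right-hand side yields a place in \<open>A\<close>.\<close>

lemma eq_min_rate_iff:
  assumes "A \<subseteq> q_in N q"
  shows "ereal x = min_rate N m w q A \<longleftrightarrow>
    (\<forall>r\<in>A. w $ r = 0 \<longrightarrow> real (a_minus N q r) * x \<le> over_tau N m $ r) \<and>
    (\<exists>r\<in>A. w $ r = 0 \<and> real (a_minus N q r) * x = over_tau N m $ r)"
proof -
  have "ereal x = min_rate N m w q A \<longleftrightarrow> ereal x \<le> min_rate N m w q A \<and>
     (\<exists>r\<in>A. w $ r = 0 \<and> x = m $ r / (real (a_minus N q r) * tau N r))"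
    unfolding min_rate_def by (subst eq_commute, subst Min_eq_iff) auto
  then show ?thesis
    using assms by (auto simp: le_min_rate_iff[OF assms] rate_iff(2) subset_iff)
qed

text \<open>The flow \<open>y\<close> left over by the prioritised transition is the term that \<open>p\<close> itself contributes to
  the minimum for \<open>q_minus\<close>. Since \<open>p\<close> has only these two output transitions, comparing it with
  the flow of \<open>q_minus\<close> amounts to comparing the processed flow of \<open>p\<close> with what \<open>p\<close> sends out.\<close>

lemma residual_iff:
  fixes m :: "real^'p" and f :: "real^'q"
  assumes "p \<in> P_priority N"
  defines "qp \<equiv> q_plus N p" and "qm \<equiv> q_minus N p"
  defines "y \<equiv> m $ p / (real (a_minus N qm p) * tau N p)
                 - real (a_minus N qp p) / real (a_minus N qm p) * f $ qp"
  shows "f $ qm \<le> y \<longleftrightarrow> (C_minus N *v f) $ p \<le> over_tau N m $ p"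
    and "f $ qm = y \<longleftrightarrow> (C_minus N *v f) $ p = over_tau N m $ p"
proof -
  have pos: "a_minus N qm p > 0"
    using priority_out[OF assms(1)] by (auto simp: qm_def p_out_def)
  then have y: "y = (over_tau N m $ p - real (a_minus N qp p) * f $ qp) / real (a_minus N qm p)"
    by (simp add: y_def over_tau_def diff_divide_distrib mult.commute)
  have "(C_minus N *v f) $ p = real (a_minus N qp p) * f $ qp + real (a_minus N qm p) * f $ qm"
    unfolding qp_def qm_def by (rule C_minus_priority[OF assms(1)])
  then show "f $ qm \<le> y \<longleftrightarrow> (C_minus N *v f) $ p \<le> over_tau N m $ p"
    and "f $ qm = y \<longleftrightarrow> (C_minus N *v f) $ p = over_tau N m $ p"
    unfolding y using pos by (auto simp: pos_le_divide_eq eq_divide_eq mult.commute)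
qed

text \<open>The two cases of the rule for \<open>q_minus\<close> are one and the same rule: \<open>p\<close> takes part in the minimum
  when \<open>w $ p = 0\<close>, with its component of \<open>C\<^sup>- f\<close> in the place of \<open>a\<^sup>-\<^sub>q\<^sub>p f\<^sub>q\<close>.\<close>

lemma priority_minus_rule_iff:
  assumes "p \<in> P_priority N"
  defines "qp \<equiv> q_plus N p" and "qm \<equiv> q_minus N p"
  shows "((w $ p \<noteq> 0 \<longrightarrow> ereal (f $ qm) = min_rate N m w qm (q_in N qm - {p})) \<and>
          (w $ p = 0 \<longrightarrow> ereal (f $ qm) =
             min (ereal (m $ p / (real (a_minus N qm p) * tau N p)
                         - real (a_minus N qp p) / real (a_minus N qm p) * f $ qp))
                 (min_rate N m w qm (q_in N qm - {p})))) \<longleftrightarrow>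
    (w $ p = 0 \<longrightarrow> (C_minus N *v f) $ p \<le> over_tau N m $ p) \<and>
    (\<forall>r\<in>q_in N qm - {p}. w $ r = 0 \<longrightarrow> real (a_minus N qm r) * f $ qm \<le> over_tau N m $ r) \<and>
    (w $ p = 0 \<and> (C_minus N *v f) $ p = over_tau N m $ p \<or>
     (\<exists>r\<in>q_in N qm - {p}. w $ r = 0 \<and> real (a_minus N qm r) * f $ qm = over_tau N m $ r))"
proof -
  have sub: "q_in N qm - {p} \<subseteq> q_in N qm" by auto
  have min_iff: "u = min v z \<longleftrightarrow> u \<le> v \<and> u \<le> z \<and> (u = v \<or> u = z)" for u v z :: ereal
    by (auto simp: min_def)
  show ?thesis
    unfolding min_iff[of "ereal _" "ereal _"] ereal_less_eq(3) ereal.inject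
      residual_iff[OF assms(1), folded qp_def qm_def] eq_min_rate_iff[OF sub] le_min_rate_iff[OF sub]
    by blast
qed

lemma flow_rules_iff:
  "flow_rules N m w f \<longleftrightarrow>
     (\<forall>q. \<exists>p\<in>q_in N q. w $ p = 0) \<and>
     (\<forall>q\<in>Q_sync N. ereal (f $ q) = min_rate N m w q (q_in N q)) \<and>
     (\<forall>p\<in>P_conflict N. \<forall>q\<in>p_out N p.
        real (a_minus N q p) * f $ q = mu N q p * over_tau N m $ p) \<and>
     (\<forall>p\<in>P_priority N. ereal (f $ q_plus N p) = min_rate N m w (q_plus N p) (q_in N (q_plus N p))) \<and>
     (\<forall>p\<in>P_priority N. w $ p = 0 \<longrightarrow> (C_minus N *v f) $ p \<le> over_tau N m $ p) \<and>
     (\<forall>p\<in>P_priority N. \<forall>r\<in>q_in N (q_minus N p) - {p}. w $ r = 0 \<longrightarrow>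
        real (a_minus N (q_minus N p) r) * f $ q_minus N p \<le> over_tau N m $ r) \<and>
     (\<forall>p\<in>P_priority N. w $ p = 0 \<and> (C_minus N *v f) $ p = over_tau N m $ p \<or>
        (\<exists>r\<in>q_in N (q_minus N p) - {p}. w $ r = 0 \<and>
           real (a_minus N (q_minus N p) r) * f $ q_minus N p = over_tau N m $ r))"
  by (simp only: flow_rules_def Let_def priority_minus_rule_iff ball_conj_distrib
        over_tau_def vec_lambda_beta cong: ball_cong)

text \<open>The place selected for a transition is one that attains the minimum in its rule: there the
  coefficients of \<open>C\<^sup>-\<^sub>\<pi>\<close> are exactly those of the attained term.\<close>

lemma flow_rules_imp_policy:
  assumes fr: "flow_rules N m w f"
  obtains \<pi> where "policy N \<pi>" "\<And>q. w $ \<pi> q = 0"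
    "\<And>q. C_minus_pol_map N \<pi> f $ q = over_tau N m $ \<pi> q"
proof -
  \<comment> \<open>Row \<open>q\<close> of \<open>C\<^sup>-\<^sub>\<pi>\<close> depends on \<open>\<pi>\<close> through \<open>\<pi> q\<close> only, so that the places can be chosen
     transition by transition.\<close>
  define transmits where "transmits q r \<longleftrightarrow> r \<in> q_in N q \<and> w $ r = 0 \<and>
    (\<forall>\<pi>. \<pi> q = r \<longrightarrow> C_minus_pol_map N \<pi> f $ q = over_tau N m $ r)" for q r
  have dedicated_transmits: "transmits q r"
    if "dedicated N q r" "r \<in> q_in N q" "w $ r = 0" "real (a_minus N q r) * f $ q = over_tau N m $ r" for q r
    using that C_minus_pol_dedicated[of N q _ f] unfolding transmits_def by auto
  have "\<exists>r. transmits q r" for q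
  proof (cases q rule: transition_cases)
    case sync
    then have "ereal (f $ q) = min_rate N m w q (q_in N q)"
      using fr by (simp add: flow_rules_def)
    then obtain r where "r \<in> q_in N q" "w $ r = 0" "real (a_minus N q r) * f $ q = over_tau N m $ r"
      unfolding eq_min_rate_iff[OF order_refl] by blast
    then show ?thesis using sync_dedicated[OF sync] dedicated_transmits by blast
  next
    case (conflict p)
    have "\<exists>r\<in>q_in N q. w $ r = 0" using fr by (simp add: flow_rules_def)
    then have "w $ p = 0" using conflict_q_in[OF conflict] by simp
    moreover have "real (a_minus N q p) * f $ q = mu N q p * over_tau N m $ p"
      using fr conflict by (simp add: flow_rules_def over_tau_def)
    then have "real (a_minus N q p) / mu N q p * f $ q = over_tau N m $ p"
      using mu_pos[OF conflict] by (simp add: field_simps)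
    ultimately have "transmits q p"
      using C_minus_pol_conflict[of _ q N f] conflict conflict_q_in[OF conflict]
      unfolding transmits_def by auto
    then show ?thesis by blast
  next
    case (priority_plus p)
    then have q: "q \<in> p_out N p" using priority_out by auto
    have "ereal (f $ q) = min_rate N m w q (q_in N q)"
      using fr priority_plus by (simp add: flow_rules_def Let_def)
    then obtain r where r: "r \<in> q_in N q" "w $ r = 0" "real (a_minus N q r) * f $ q = over_tau N m $ r"
      unfolding eq_min_rate_iff[OF order_refl] by blast
    have "transmits q r"
    proof (cases "r = p")
      case True
      then show ?thesis
        using r priority_plus C_minus_pol_priority(1)[of _ q f] unfolding transmits_def by auto
    next
      case False
      then show ?thesis
        using r priority_dedicated[OF priority_plus(1) q] dedicated_transmits by blast
    qed
    then show ?thesis by blast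
  next
    case (priority_minus p)
    then have q: "q \<in> p_out N p" using priority_out by auto
    have "w $ p = 0 \<and> (C_minus N *v f) $ p = over_tau N m $ p \<or>
        (\<exists>r\<in>q_in N q - {p}. w $ r = 0 \<and> real (a_minus N q r) * f $ q = over_tau N m $ r)"
      using fr[unfolded flow_rules_iff, THEN conjunct2, THEN conjunct2, THEN conjunct2,
          THEN conjunct2, THEN conjunct2, THEN conjunct2] priority_minus by blast
    then show ?thesis
    proof (elim disjE conjE bexE)
      assume p: "w $ p = 0" "(C_minus N *v f) $ p = over_tau N m $ p"
      have "C_minus_pol_map N \<pi> f $ q = over_tau N m $ p" if "\<pi> q = p" for \<pi>
        using C_minus_pol_priority(2)[of \<pi> q f] that priority_minus p(2)
          C_minus_priority[OF priority_minus(1), of f] by simp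
      then have "transmits q p" using p(1) q by (simp add: transmits_def q_in_iff_p_out)
      then show ?thesis by blast
    next
      fix r assume "r \<in> q_in N q - {p}" "w $ r = 0" "real (a_minus N q r) * f $ q = over_tau N m $ r"
      then show ?thesis using priority_dedicated[OF priority_minus(1) q] dedicated_transmits by blast
    qed
  qed
  then obtain \<pi> where "\<And>q. transmits q (\<pi> q)" by metis
  then show thesis by (intro that[of \<pi>]) (simp_all add: policy_def transmits_def)
qed

text \<open>The inequality \<open>C\<^sup>- f \<le> m/\<tau>\<close> gives the upper bounds in all the rules; for \<open>q_plus\<close> and the
  priority place itself this uses that the flow of \<open>q_minus\<close> is nonnegative. The place selected by
  the policy gives equality.\<close>

lemma policy_imp_flow_rules:
  assumes f: "0 \<le> f" and le: "C_minus N *v f \<le> over_tau N m"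
    and pol: "policy N \<pi>" and w0: "\<And>q. w $ \<pi> q = 0"
    and eq: "\<And>q. C_minus_pol_map N \<pi> f $ q = over_tau N m $ \<pi> q"
  shows "flow_rules N m w f"
proof -
  have \<pi>_in: "\<pi> q \<in> q_in N q" for q using pol by (simp add: policy_def)
  have le': "(C_minus N *v f) $ p \<le> over_tau N m $ p" for p using le by (simp add: less_eq_vec_def)
  have ded_le: "real (a_minus N q r) * f $ q \<le> over_tau N m $ r" if "dedicated N q r" for q r
    using le'[of r] C_minus_dedicated[OF that, of f] by simp
  have ded_eq: "real (a_minus N q (\<pi> q)) * f $ q = over_tau N m $ \<pi> q" if "dedicated N q (\<pi> q)" for q
    using eq[of q] C_minus_pol_dedicated[of N q \<pi> f] that by simp
  have sync: "ereal (f $ q) = min_rate N m w q (q_in N q)" if "q \<in> Q_sync N" for q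
    using sync_dedicated[OF that] ded_le ded_eq \<pi>_in w0 unfolding eq_min_rate_iff[OF order_refl] by blast
  have conflict: "real (a_minus N q p) * f $ q = mu N q p * over_tau N m $ p"
    if "p \<in> P_conflict N" "q \<in> p_out N p" for p q
  proof -
    have "\<pi> q = p" using \<pi>_in[of q] conflict_q_in[OF that] by simp
    then have "real (a_minus N q p) / mu N q p * f $ q = over_tau N m $ p"
      using eq[of q] C_minus_pol_conflict[of \<pi> q N f] that by simp
    then show ?thesis using mu_pos[OF that] by (simp add: field_simps)
  qed
  have plus: "ereal (f $ q) = min_rate N m w q (q_in N q)"
    if pq: "p \<in> P_priority N" "q = q_plus N p" for p q
  proof -
    have q: "q \<in> p_out N p" using pq priority_out by auto
    have "real (a_minus N q r) * f $ q \<le> over_tau N m $ r" if r: "r \<in> q_in N q" for r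
    proof (cases "r = p")
      case True
      have "0 \<le> real (a_minus N (q_minus N p) p) * f $ q_minus N p"
        using f by (simp add: less_eq_vec_def)
      then show ?thesis
        using le'[of p] C_minus_priority[OF pq(1), of f] pq(2) True by simp
    next
      case False
      then show ?thesis using ded_le priority_dedicated[OF pq(1) q] r by blast
    qed
    moreover have "real (a_minus N q (\<pi> q)) * f $ q = over_tau N m $ \<pi> q"
    proof (cases "\<pi> q = p")
      case True
      then show ?thesis using C_minus_pol_priority(1)[of \<pi> q f] pq eq[of q] by simp
    next
      case False
      then show ?thesis using ded_eq priority_dedicated[OF pq(1) q] \<pi>_in[of q] by blast
    qed
    ultimately show ?thesis using \<pi>_in w0 unfolding eq_min_rate_iff[OF order_refl] by blast
  qed
  have minus: "w $ p = 0 \<and> (C_minus N *v f) $ p = over_tau N m $ p \<or>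
     (\<exists>r\<in>q_in N q - {p}. w $ r = 0 \<and> real (a_minus N q r) * f $ q = over_tau N m $ r)"
    if "p \<in> P_priority N" "q = q_minus N p" for p q
  proof (cases "\<pi> q = p")
    case True
    then have "(C_minus N *v f) $ p = over_tau N m $ p"
      using C_minus_pol_priority(2)[of \<pi> q f] that eq[of q] C_minus_priority[OF that(1), of f] by simp
    then show ?thesis using True w0[of q] by blast
  next
    case False
    have q: "q \<in> p_out N p" using that priority_out by auto
    then have "real (a_minus N q (\<pi> q)) * f $ q = over_tau N m $ \<pi> q"
      using False ded_eq priority_dedicated[OF that(1) q] \<pi>_in[of q] by blast
    then show ?thesis using False \<pi>_in[of q] w0[of q] by blast
  qed
  have minus_le: "real (a_minus N q r) * f $ q \<le> over_tau N m $ r"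
    if "p \<in> P_priority N" "q = q_minus N p" "r \<in> q_in N q - {p}" for p q r
    using ded_le priority_dedicated[OF that(1) _ that(3)] priority_out[OF that(1)] that(2) by blast
  show ?thesis
    unfolding flow_rules_iff
  proof (intro conjI)
    show "\<forall>q. \<exists>p\<in>q_in N q. w $ p = 0" using \<pi>_in w0 by blast
  qed (use sync conflict plus minus minus_le le' in \<open>blast+\<close>)
qed

text \<open>The flow of a transition with a dedicated upstream place \<open>r\<close> can be read off component \<open>r\<close> of
  \<open>C\<^sup>- f\<close>, and after a conflict place it is a fixed fraction of the processed flow. A transition
  \<open>q_plus\<close> without a dedicated upstream place has the priority place as its only upstream place,
  so that its minimum has a single term in both configurations; the flow of \<open>q_minus\<close> is then what
  remains in the component of \<open>C\<^sup>- f\<close> at its priority place.\<close>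

lemma flow_rules_unique:
  assumes fr: "flow_rules N m w f" "flow_rules N m w' f'"
    and C: "C_minus N *v f = C_minus N *v f'"
  shows "f = f'"
proof -
  have ded: "f $ q = f' $ q" if "dedicated N q r" for q r
  proof -
    have "a_minus N q r > 0" using that by (auto simp: dedicated_def p_out_def)
    then show ?thesis
      using C_minus_dedicated[OF that, of f] C_minus_dedicated[OF that, of f'] C by simp
  qed
  have plus: "f $ q = f' $ q" if pq: "p \<in> P_priority N" "q = q_plus N p" for p q
  proof (cases "q_in N q = {p}")
    case True
    have rule: "real (a_minus N q p) * g $ q = over_tau N m $ p" if "flow_rules N m v g" for v g
    proof -
      have "ereal (g $ q) = min_rate N m v q (q_in N q)"
        using that pq by (simp add: flow_rules_def Let_def)
      then show ?thesis using True eq_min_rate_iff[of "q_in N q" q "g $ q" m v] by simp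
    qed
    have "a_minus N q p > 0" using True by (auto simp: q_in_def)
    then show ?thesis using rule[OF fr(1)] rule[OF fr(2)]
      by (metis mult_left_cancel of_nat_0_less_iff less_irrefl)
  next
    case False
    have q: "q \<in> p_out N p" using pq priority_out by auto
    then obtain r where "r \<in> q_in N q - {p}" using False by (auto simp flip: q_in_iff_p_out)
    then show ?thesis using ded priority_dedicated pq q by blast
  qed
  have "f $ q = f' $ q" for q
  proof (cases q rule: transition_cases)
    case sync
    then show ?thesis using autonomous[of q] sync_dedicated[OF sync] ded by blast
  next
    case (conflict p)
    then have "real (a_minus N q p) * f $ q = real (a_minus N q p) * f' $ q"
      using fr by (simp add: flow_rules_def)
    then show ?thesis using conflict(2) by (simp add: p_out_def)
  next
    case (priority_plus p)
    then show ?thesis using plus by blast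
  next
    case (priority_minus p)
    have "a_minus N q p > 0" using priority_minus priority_out by (auto simp: p_out_def)
    then show ?thesis
      using C_minus_priority[OF priority_minus(1), of f] C_minus_priority[OF priority_minus(1), of f']
        C plus[OF priority_minus(1) refl] priority_minus by simp
  qed
  then show ?thesis by (simp add: vec_eq_iff)
qed

end

section \<open>Stationary solutions\<close>

lemma S_pol_nth: "(S_pol \<pi> *v x) $ q = x $ \<pi> q"
  by (simp add: S_pol_def matrix_vector_mult_def if_distrib[of "\<lambda>c. c * _"] cong: if_cong)

lemma policy_conditions_iff:
  "S_pol \<pi> *v w = 0 \<longleftrightarrow> (\<forall>q. w $ \<pi> q = 0)"
  "(S_pol \<pi> ** C_plus N - C_minus_pol N \<pi>) *v f = 0 \<longleftrightarrow>
     (\<forall>q. C_minus_pol_map N \<pi> f $ q = (C_plus N *v f) $ \<pi> q)"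
  by (auto simp: vec_eq_iff S_pol_nth matrix_vector_mult_diff_rdistrib C_minus_pol_mult
      matrix_vector_mul_assoc[symmetric])

theorem theorem5:
  fixes N :: "('p::finite, 'q::finite) petri_net"
    and m w :: "real \<Rightarrow> real^'p"
    and f :: "real \<Rightarrow> real^'q"
  assumes "fc_priority_net N"
    and "\<forall>t\<ge>0. 0 \<le> m t \<and> 0 \<le> w t \<and> 0 \<le> f t"
    and "\<forall>p. (\<lambda>t. m t $ p) constant_on {0..}"
    and "\<forall>p. affine_on_nonneg (\<lambda>t. w t $ p)"
  shows "stationary_solution N m w f \<longleftrightarrow>
    (\<forall>t\<ge>0. over_tau N (m t) = C_plus N *v f t) \<and>
    (\<forall>t\<ge>0. (w has_vector_derivative (over_tau N (m t) - C_minus N *v f t)) (at t within {0..})) \<and>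
    (\<forall>t\<ge>0. 0 \<le> C_mat N *v f t) \<and>
    (\<exists>\<pi>. policy N \<pi> \<and>
      (\<forall>t\<ge>0. S_pol \<pi> *v w t = 0) \<and>
      (\<forall>t\<ge>0. (S_pol \<pi> ** C_plus N - C_minus_pol N \<pi>) *v f t = 0))"
proof -
  interpret fc_priority_net N by fact
  have mc: "m s = m t" if "s \<ge> 0" "t \<ge> 0" for s t
    using assms(3) that unfolding vec_eq_iff constant_on_def by (metis atLeast_iff)
  have w_nonneg: "\<forall>t\<ge>0. 0 \<le> w t" using assms(2) by simp
  note w_slope = affine_derivative_nonneg_const[OF assms(4) w_nonneg]
  show ?thesis
  proof (intro iffI conjI)
    assume "stationary_solution N m w f"
    then have
      dm: "\<forall>t\<ge>0. (m has_vector_derivative (C_plus N *v f t - over_tau N (m t))) (at t within {0..})" and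
      dw: "\<forall>t\<ge>0. (w has_vector_derivative (over_tau N (m t) - C_minus N *v f t)) (at t within {0..})" and
      fr: "\<And>t. t \<ge> 0 \<Longrightarrow> flow_rules N (m t) (w t) (f t)"
      by (simp_all add: stationary_solution_def continuous_dynamics_def)
    have m_eq: "over_tau N (m t) = C_plus N *v f t" if "t \<ge> 0" for t
    proof -
      have "C_plus N *v f t - over_tau N (m t) = 0"
        by (rule half_line_derivative_unique[OF dm[rule_format, OF that] has_vector_derivative_const])
          (use mc that in blast)+
      then show ?thesis by simp
    qed
    have f_const: "f t = f 1" if "t \<ge> 0" for t
    proof (rule flow_rules_unique)
      show "flow_rules N (m 1) (w t) (f t)" using fr[OF that] mc[OF that, of 1] by simp
      show "flow_rules N (m 1) (w 1) (f 1)" using fr by simp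
      have "over_tau N (m t) - C_minus N *v f t = over_tau N (m 1) - C_minus N *v f 1"
        using w_slope(2)[OF dw that, of 1] by simp
      then show "C_minus N *v f t = C_minus N *v f 1" using mc[OF that, of 1] by simp
    qed
    show "\<forall>t\<ge>0. over_tau N (m t) = C_plus N *v f t" using m_eq by blast
    show "\<forall>t\<ge>0. (w has_vector_derivative (over_tau N (m t) - C_minus N *v f t)) (at t within {0..})"
      by (rule dw)
    show "\<forall>t\<ge>0. 0 \<le> C_mat N *v f t"
      using w_slope(1)[OF dw] m_eq by (simp add: C_mat_def matrix_vector_mult_diff_rdistrib)
    obtain \<pi> where \<pi>: "policy N \<pi>" "\<And>q. w 1 $ \<pi> q = 0"
      "\<And>q. C_minus_pol_map N \<pi> (f 1) $ q = over_tau N (m 1) $ \<pi> q"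
      using flow_rules_imp_policy[OF fr[OF zero_le_one]] by blast
    have w0: "w t $ \<pi> q = 0" if "t \<ge> 0" for t q
    proof (rule nonneg_affine_zero[OF assms(4)[rule_format], of "\<pi> q" 1])
      show "0 \<le> w s $ \<pi> q" if "s \<ge> 0" for s
        using w_nonneg that by (simp add: less_eq_vec_def)
    qed (use \<pi>(2) that in simp_all)
    have "C_minus_pol_map N \<pi> (f t) $ q = (C_plus N *v f t) $ \<pi> q" if "t \<ge> 0" for t q
      using \<pi>(3)[of q] f_const[OF that] m_eq[OF zero_le_one] by simp
    with \<pi>(1) w0 show "\<exists>\<pi>. policy N \<pi> \<and> (\<forall>t\<ge>0. S_pol \<pi> *v w t = 0) \<and>
        (\<forall>t\<ge>0. (S_pol \<pi> ** C_plus N - C_minus_pol N \<pi>) *v f t = 0)"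
      unfolding policy_conditions_iff by blast
  next
    assume R: "(\<forall>t\<ge>0. over_tau N (m t) = C_plus N *v f t) \<and>
      (\<forall>t\<ge>0. (w has_vector_derivative (over_tau N (m t) - C_minus N *v f t)) (at t within {0..})) \<and>
      (\<forall>t\<ge>0. 0 \<le> C_mat N *v f t) \<and>
      (\<exists>\<pi>. policy N \<pi> \<and> (\<forall>t\<ge>0. S_pol \<pi> *v w t = 0) \<and>
        (\<forall>t\<ge>0. (S_pol \<pi> ** C_plus N - C_minus_pol N \<pi>) *v f t = 0))"
    then obtain \<pi> where \<pi>: "policy N \<pi>" "\<And>t q. t \<ge> 0 \<Longrightarrow> w t $ \<pi> q = 0"
      "\<And>t q. t \<ge> 0 \<Longrightarrow> C_minus_pol_map N \<pi> (f t) $ q = over_tau N (m t) $ \<pi> q"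
      unfolding policy_conditions_iff by force
    have "flow_rules N (m t) (w t) (f t)" if t: "t \<ge> 0" for t
    proof (rule policy_imp_flow_rules[OF _ _ \<pi>(1) \<pi>(2)[OF t] \<pi>(3)[OF t]])
      show "0 \<le> f t" using assms(2) t by blast
      show "C_minus N *v f t \<le> over_tau N (m t)"
        using R t by (simp add: C_mat_def matrix_vector_mult_diff_rdistrib)
    qed
    moreover have "(m has_vector_derivative (C_plus N *v f t - over_tau N (m t))) (at t within {0..})"
      if t: "t \<ge> 0" for t
    proof -
      have "(m has_vector_derivative 0) (at t within {0..})"
      proof (rule has_vector_derivative_transform[OF _ _ has_vector_derivative_const])
        show "m s = m 0" if "s \<in> {0..}" for s using mc[of s 0] that by simp
      qed (use t in simp)
      then show ?thesis using R t by simp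
    qed
    ultimately show "stationary_solution N m w f"
      unfolding stationary_solution_def continuous_dynamics_def using assms(2-4) R by (intro conjI) blast+
  qed
qed

end
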